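(* Let $M$ be a metric space containing a thick family of geodesics. Then there is no biLipschitz embedding of $M$ into any Banach space with the Radon-Nikod\'ym property.
   Context: A $p$-$q$ geodesic in a metric space $(M,d)$ is an isometric embedding of a compact interval into $M$ sending the left endpoint to $p$ and the right endpoint to $q$. A nonempty family $\Gamma$ of $p$-$q$ geodesics with common domain $[a,b]$ is concatenation closed if whenever $\gamma_1,\gamma_2\in\Gamma$, $c\in[a,b]$ and $\gamma_1(c)=\gamma_2(c)$, the curve equal to $\gamma_1$ on $[a,c]$ and to $\gamma_2$ on $[c,b]$ belongs to $\Gamma$. A thick family of geodesics is a nonempty concatenation closed family $\Gamma$ of $p$-$q$ geodesics (for some points $p,q\in M$) with common domain $[a,b]$ for which there is $\alpha>0$ such that for every $\gamma\in\Gamma$ and $a=t_0<t_1<\dots<t_k=b$ there exist $a=q_0<s_1<q_1<s_2<\dots<s_j<q_j=b$ and $\tilde\gamma\in\Gamma$ with $\{t_i\}\subseteq\{q_i\}$, $\gamma(q_i)=\tilde\gamma(q_i)$ for all $i$, and $\sum_{i=1}^j d(\gamma(s_i),\tilde\gamma(s_i))\ge\alpha$. A Banach space $B$ has the Radon-Nikod\'ym property (RNP) if every Lipschitz map $\mathbb R\to B$ is differentiable Lebesgue-almost everywhere. *)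

theory Defs
  imports "HOL-Analysis.Analysis"
begin

context Metric_space
begin

text \<open>
  A curve with domain \<open>[a, b]\<close> is an element of \<open>{a..b} \<rightarrow>\<^sub>E M\<close>, so that two curves are
  equal as functions exactly if they agree on \<open>[a, b]\<close>.
\<close>

definition geodesic_between :: "'a \<Rightarrow> 'a \<Rightarrow> real \<Rightarrow> real \<Rightarrow> (real \<Rightarrow> 'a) \<Rightarrow> bool" where
  "geodesic_between p q a b \<gamma> \<longleftrightarrow>
     a \<le> b \<and> \<gamma> \<in> {a..b} \<rightarrow>\<^sub>E M \<and>
     (\<forall>s\<in>{a..b}. \<forall>t\<in>{a..b}. d (\<gamma> s) (\<gamma> t) = dist s t) \<and>
     \<gamma> a = p \<and> \<gamma> b = q"

definition concatenation_closed :: "real \<Rightarrow> real \<Rightarrow> (real \<Rightarrow> 'a) set \<Rightarrow> bool" where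
  "concatenation_closed a b \<Gamma> \<longleftrightarrow>
     (\<forall>\<gamma>1\<in>\<Gamma>. \<forall>\<gamma>2\<in>\<Gamma>. \<forall>c\<in>{a..b}. \<gamma>1 c = \<gamma>2 c \<longrightarrow>
        (\<lambda>t\<in>{a..b}. if t \<le> c then \<gamma>1 t else \<gamma>2 t) \<in> \<Gamma>)"

text \<open>
  The finite sequences \<open>t\<^sub>0, \<dots>, t\<^sub>k\<close>; \<open>r\<^sub>0, \<dots>, r\<^sub>j\<close>; and \<open>s\<^sub>1, \<dots>, s\<^sub>j\<close> are functions on \<open>nat\<close> of
  which only the values at these indices matter. The subdivision with \<open>k = 0\<close> is admitted. It
  exists only if \<open>a = b\<close>, and then it forces \<open>j = 0\<close> and an empty sum, so families of constant
  geodesics are not thick.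
\<close>

definition thick_family :: "'a \<Rightarrow> 'a \<Rightarrow> real \<Rightarrow> real \<Rightarrow> (real \<Rightarrow> 'a) set \<Rightarrow> bool" where
  "thick_family p q a b \<Gamma> \<longleftrightarrow>
     \<Gamma> \<noteq> {} \<and> (\<forall>\<gamma>\<in>\<Gamma>. geodesic_between p q a b \<gamma>) \<and> concatenation_closed a b \<Gamma> \<and>
     (\<exists>\<alpha>>0. \<forall>\<gamma>\<in>\<Gamma>. \<forall>(k::nat) (t::nat \<Rightarrow> real).
        t 0 = a \<and> t k = b \<and> (\<forall>i<k. t i < t (Suc i)) \<longrightarrow>
        (\<exists>(j::nat) (r::nat \<Rightarrow> real) (s::nat \<Rightarrow> real). \<exists>\<gamma>'\<in>\<Gamma>.
           r 0 = a \<and> r j = b \<and> (\<forall>i\<in>{1..j}. r (i - 1) < s i \<and> s i < r i) \<and>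
           t ` {0..k} \<subseteq> r ` {0..j} \<and>
           (\<forall>i\<in>{0..j}. \<gamma> (r i) = \<gamma>' (r i)) \<and>
           (\<Sum>i=1..j. d (\<gamma> (s i)) (\<gamma>' (s i))) \<ge> \<alpha>))"

definition bilipschitz_embedding :: "('a \<Rightarrow> 'b::metric_space) \<Rightarrow> bool" where
  "bilipschitz_embedding f \<longleftrightarrow>
     (\<exists>c>0. \<exists>C>0. \<forall>x\<in>M. \<forall>y\<in>M. c * d x y \<le> dist (f x) (f y) \<and> dist (f x) (f y) \<le> C * d x y)"

end

definition radon_nikodym_property :: "'b::banach itself \<Rightarrow> bool" where
  "radon_nikodym_property _ \<longleftrightarrow>
     (\<forall>f::real \<Rightarrow> 'b. (\<exists>L. L-lipschitz_on UNIV f) \<longrightarrow> (AE x in lebesgue. f differentiable (at x)))"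

end

theory Submission
  imports Defs
begin

text \<open>
  Suppose that \<open>f\<close> is a biLipschitz embedding into a Banach space with the RNP. Given \<open>\<gamma> \<in> \<Gamma>\<close>,
  thickness yields a fine subdivision \<open>r\<close>, intermediate points \<open>s\<close> and \<open>\<gamma>' \<in> \<Gamma>\<close> agreeing with \<open>\<gamma>\<close>
  at the points \<open>r\<^sub>i\<close>. By the triangle inequality one of \<open>f \<circ> \<gamma>\<close>, \<open>f \<circ> \<gamma>'\<close> deviates at the points \<open>s\<^sub>i\<close>
  from the common affine interpolation through the \<open>r\<^sub>i\<close> by a total amount bounded below. Replacing
  \<open>\<gamma>\<close> by that geodesic and iterating, with all previous points kept in the subdivision, gives
  curves that converge to a Lipschitz curve whose total deviations from chords along ever finer
  subdivisions stay bounded below. Almost everywhere differentiability and dominated convergence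
  force these deviations to tend to zero.
\<close>

section \<open>Deviation of a curve from its chords\<close>

text \<open>The distance at \<open>s\<close> from \<open>F\<close> to the affine function that takes
  the values of \<open>F\<close> at \<open>u\<close> and \<open>v\<close>.\<close>

definition chord_deviation :: "(real \<Rightarrow> 'b::real_normed_vector) \<Rightarrow> real \<Rightarrow> real \<Rightarrow> real \<Rightarrow> real" where
  "chord_deviation F u s v = norm (F s - F u - ((s - u) / (v - u)) *\<^sub>R (F v - F u))"

lemma chord_deviation_cong:
  "F u = G u \<Longrightarrow> F s = G s \<Longrightarrow> F v = G v \<Longrightarrow> chord_deviation F u s v = chord_deviation G u s v"
  by (simp add: chord_deviation_def)

text \<open>Both curves have the same chord over \<open>u\<close>, \<open>v\<close>, so the triangle
  inequality can be applied through the point of that chord at \<open>s\<close>.\<close>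

lemma norm_diff_le_chord_deviation:
  assumes "F u = G u" "F v = G v"
  shows "norm (F s - G s) \<le> chord_deviation F u s v + chord_deviation G u s v"
  unfolding chord_deviation_def assms
  using norm_triangle_ineq4[of "F s - G u - ((s - u) / (v - u)) *\<^sub>R (G v - G u)"
      "G s - G u - ((s - u) / (v - u)) *\<^sub>R (G v - G u)"] by simp

lemma chord_deviation_le:
  assumes "u < s" "s < v"
    and "norm (F s - F u) \<le> K" "norm (F v - F u) \<le> K"
  shows "chord_deviation F u s v \<le> 2 * K"
proof -
  have "norm (((s - u) / (v - u)) *\<^sub>R (F v - F u)) \<le> 1 * norm (F v - F u)"
    unfolding norm_scaleR using assms(1,2) by (intro mult_right_mono) auto
  then show ?thesis
    unfolding chord_deviation_def
    using norm_triangle_ineq4[of "F s - F u" "((s - u) / (v - u)) *\<^sub>R (F v - F u)"] assms(3,4)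
    by linarith
qed

lemma chord_deviation_le_lipschitz:
  assumes "L-lipschitz_on UNIV F" "u < s" "s < v"
  shows "chord_deviation F u s v \<le> 2 * L * (v - u)"
proof -
  have L: "0 \<le> L" using assms(1) by (rule lipschitz_on_nonneg)
  have *: "norm (F x - F u) \<le> L * (v - u)" if "u < x" "x \<le> v" for x
  proof -
    have "norm (F x - F u) \<le> L * \<bar>x - u\<bar>"
      using lipschitz_onD[OF assms(1), of x u] by (simp add: dist_norm)
    also have "\<dots> \<le> L * (v - u)" using L that by (intro mult_left_mono) auto
    finally show ?thesis .
  qed
  show ?thesis using chord_deviation_le[OF assms(2,3) *[of s] *[of v]] assms(2,3) by simp
qed

text \<open>Linear maps have deviation zero, so subtracting the derivative at \<open>t\<close> does
  not change the deviation, and what is left is o(x - t). Since \<open>t\<close> lies between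
  \<open>u\<close> and \<open>v\<close>, all distances to \<open>t\<close> are at most
  \<open>v - u\<close>, which makes the bound uniform in \<open>s\<close>.\<close>

lemma chord_deviation_small_if_differentiable:
  fixes F :: "real \<Rightarrow> 'b::real_normed_vector"
  assumes "F differentiable (at t)" "e > 0"
  obtains \<delta> where "\<delta> > 0"
    "\<And>u s v. u < t \<Longrightarrow> t < v \<Longrightarrow> u < s \<Longrightarrow> s < v \<Longrightarrow> v - u < \<delta> \<Longrightarrow> chord_deviation F u s v \<le> e * (v - u)"
proof -
  obtain D where D: "(F has_derivative D) (at t)"
    using assms(1) unfolding differentiable_def by blast
  then interpret D: bounded_linear D by (rule has_derivative_bounded_linear)
  \<comment> \<open>The factor \<open>e / 4\<close> is doubled twice below: when the base point
    moves from \<open>t\<close> to \<open>u\<close>, and in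
    \<open>chord_deviation_le\<close>.\<close>
  from D obtain \<delta> where \<delta>: "\<delta> > 0"
    and approx: "\<And>x. norm (x - t) < \<delta> \<Longrightarrow> norm (F x - F t - D (x - t)) \<le> e / 4 * norm (x - t)"
    unfolding has_derivative_at_alt using assms(2) by (metis divide_pos_pos zero_less_numeral)
  show thesis
  proof (rule that[OF \<delta>])
    fix u s v assume uv: "u < t" "t < v" and s: "u < s" "s < v" and "v - u < \<delta>"
    define R where "R x = F x - D x" for x
    have R: "norm (R x - R t) \<le> e / 4 * (v - u)" if "u \<le> x" "x \<le> v" for x
    proof -
      have "norm (R x - R t) \<le> e / 4 * \<bar>x - t\<bar>"
        using approx[of x] that uv \<open>v - u < \<delta>\<close> by (simp add: R_def D.diff algebra_simps)
      also have "\<dots> \<le> e / 4 * (v - u)"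
        using that uv assms(2) by (intro mult_left_mono) auto
      finally show ?thesis .
    qed
    have R': "norm (R x - R u) \<le> e / 2 * (v - u)" if "u \<le> x" "x \<le> v" for x
      using norm_triangle_ineq4[of "R x - R t" "R u - R t"] R[OF that] R[of u] uv by simp
    have "D (s - u) = D (((s - u) / (v - u)) *\<^sub>R (v - u))"
      using s by simp
    then have "D s - D u = ((s - u) / (v - u)) *\<^sub>R (D v - D u)"
      by (simp only: D.scaleR D.diff)
    then have "F s - F u - ((s - u) / (v - u)) *\<^sub>R (F v - F u) =
        R s - R u - ((s - u) / (v - u)) *\<^sub>R (R v - R u)"
      unfolding R_def scaleR_right_diff_distrib by (simp add: algebra_simps)
    then have "chord_deviation F u s v = chord_deviation R u s v"
      by (simp only: chord_deviation_def)
    also have "\<dots> \<le> e * (v - u)"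
      using chord_deviation_le[OF s R'[of s] R'[of v]] s by simp
    finally show "chord_deviation F u s v \<le> e * (v - u)" .
  qed
qed

section \<open>Order properties of subdivisions\<close>

lemma subdivision_less:
  fixes r :: "nat \<Rightarrow> real"
  assumes "\<forall>i\<in>{1..j}. r (i - 1) < r i" "m < n" "n \<le> j"
  shows "r m < r n"
  using assms(2,3)
proof (induction n)
  case (Suc n)
  then have "r n < r (Suc n)" using bspec[OF assms(1), of "Suc n"] by simp
  with Suc show ?case by (cases "m = n") auto
qed simp

lemma subdivision_le:
  fixes r :: "nat \<Rightarrow> real"
  assumes "\<forall>i\<in>{1..j}. r (i - 1) < r i" "m \<le> n" "n \<le> j"
  shows "r m \<le> r n"
  using subdivision_less[OF assms(1), of m n] assms(2,3) by (cases "m = n") auto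

lemma subdivision_interval_unique:
  fixes r :: "nat \<Rightarrow> real"
  assumes "\<forall>i\<in>{1..j}. r (i - 1) < r i" "i \<in> {1..j}" "i' \<in> {1..j}"
    and "t \<in> {r (i - 1)<..<r i}" "t \<in> {r (i' - 1)<..<r i'}"
  shows "i = i'"
proof (rule ccontr)
  assume "i \<noteq> i'"
  then consider "i \<le> i' - 1" | "i' \<le> i - 1" by linarith
  then show False
  proof cases
    case 1
    have "r i \<le> r (i' - 1)" using assms(3) by (intro subdivision_le[OF assms(1) 1]) auto
    then show ?thesis using assms(4,5) by auto
  next
    case 2
    have "r i' \<le> r (i - 1)" using assms(2) by (intro subdivision_le[OF assms(1) 2]) auto
    then show ?thesis using assms(4,5) by auto
  qed
qed

lemma subdivision_no_point_between:
  fixes r :: "nat \<Rightarrow> real"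
  assumes "\<forall>i\<in>{1..j}. r (i - 1) < r i" "i \<in> {1..j}" "x \<in> r ` {0..j}"
  shows "x \<notin> {r (i - 1)<..<r i}"
proof
  assume x: "x \<in> {r (i - 1)<..<r i}"
  from assms(3) obtain m where m: "m \<le> j" "x = r m" by auto
  show False
  proof (cases "m \<le> i - 1")
    case True
    then have "r m \<le> r (i - 1)" using assms(2) by (intro subdivision_le[OF assms(1)]) auto
    then show False using x m by auto
  next
    case False
    then have "r i \<le> r m" using m by (intro subdivision_le[OF assms(1)]) auto
    then show False using x m by auto
  qed
qed

section \<open>Total deviation along ever finer subdivisions\<close>

text \<open>The sum is the integral of the step function \<open>E n\<close>, whose value on each
  subdivision interval is the deviation divided by the length. The Lipschitz bound dominates these
  functions by \<open>2 * L\<close> on \<open>[a, b]\<close>, and they tend to zero wherever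
  \<open>F\<close> is differentiable, so dominated convergence applies.\<close>

lemma total_chord_deviation_vanishes:
  fixes F :: "real \<Rightarrow> 'b::real_normed_vector"
    and r s :: "nat \<Rightarrow> nat \<Rightarrow> real" and j :: "nat \<Rightarrow> nat"
  assumes lip: "L-lipschitz_on UNIV F"
    and diff: "AE x in lebesgue. F differentiable (at x)"
    and ends: "\<And>n. r n 0 = a" "\<And>n. r n (j n) = b"
    and rs: "\<And>n. \<forall>i\<in>{1..j n}. r n (i - 1) < s n i \<and> s n i < r n i"
    and mesh: "\<And>n. \<forall>i\<in>{1..j n}. r n i - r n (i - 1) < \<epsilon> n" and \<epsilon>: "\<epsilon> \<longlonglongrightarrow> 0"
  shows "(\<lambda>n. \<Sum>i=1..j n. chord_deviation F (r n (i - 1)) (s n i) (r n i)) \<longlonglongrightarrow> 0"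
proof -
  define q where
    "q n i = chord_deviation F (r n (i - 1)) (s n i) (r n i) / (r n i - r n (i - 1))" for n i
  \<comment> \<open>With open intervals at most one summand is nonzero at any \<open>t\<close>, and
    a \<open>t\<close> in one of them lies strictly between its ends, as the estimate at a point of
    differentiability demands. At subdivision points \<open>E n\<close> is zero.\<close>
  define E where
    "E n t = (\<Sum>i=1..j n. q n i * indicator {r n (i - 1)<..<r n i} t)" for n and t :: real
  have r: "\<forall>i\<in>{1..j n}. r n (i - 1) < r n i" for n using rs[of n] by fastforce
  have L: "0 \<le> L" using lip by (rule lipschitz_on_nonneg)
  have q: "0 \<le> q n i" "q n i \<le> 2 * L" if "i \<in> {1..j n}" for n i
  proof -
    show "0 \<le> q n i"
      using r that by (auto simp: q_def chord_deviation_def intro!: divide_nonneg_pos)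
    show "q n i \<le> 2 * L"
      using chord_deviation_le_lipschitz[OF lip, of "r n (i - 1)" "s n i" "r n i"]
        rs[of n] r[of n] that
      by (auto simp: q_def divide_le_eq)
  qed
  have E_eq: "E n t = q n i" if "i \<in> {1..j n}" "t \<in> {r n (i - 1)<..<r n i}" for n i t
  proof -
    have "E n t = (\<Sum>i'=1..j n. if i' = i then q n i else 0)"
      unfolding E_def
    proof (rule sum.cong[OF refl])
      fix i' assume "i' \<in> {1..j n}"
      then have "t \<in> {r n (i' - 1)<..<r n i'} \<longleftrightarrow> i' = i"
        using subdivision_interval_unique[OF r that(1)] that(2) by blast
      then show "q n i' * indicator {r n (i' - 1)<..<r n i'} t = (if i' = i then q n i else 0)"
        by (simp only: indicator_def) simp
    qed
    then show ?thesis using that(1) by simp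
  qed
  have E_0: "E n t = 0" if "\<And>i. i \<in> {1..j n} \<Longrightarrow> t \<notin> {r n (i - 1)<..<r n i}" for n t
    unfolding E_def using that by (intro sum.neutral) (simp add: indicator_def)
  have bound: "\<bar>E n t\<bar> \<le> 2 * L * indicator {a..b} t" for n t
  proof (cases "\<exists>i\<in>{1..j n}. t \<in> {r n (i - 1)<..<r n i}")
    case True
    then obtain i where i: "i \<in> {1..j n}" "t \<in> {r n (i - 1)<..<r n i}" by blast
    have "r n 0 \<le> r n (i - 1)" "r n i \<le> r n (j n)"
      using i(1) by (auto intro!: subdivision_le[OF r])
    then have "t \<in> {a..b}" using i(2) ends[of n] by auto
    then show ?thesis using E_eq[OF i] q[OF i(1)] by simp
  next
    case False
    then show ?thesis using E_0[of n t] L by auto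
  qed
  have lim: "(\<lambda>n. E n t) \<longlonglongrightarrow> 0" if t: "F differentiable (at t)" for t
  proof (rule LIMSEQ_I)
    fix e :: real assume "e > 0"
    then obtain \<delta> where \<delta>: "\<delta> > 0" and small:
      "\<And>u s v. u < t \<Longrightarrow> t < v \<Longrightarrow> u < s \<Longrightarrow> s < v \<Longrightarrow> v - u < \<delta> \<Longrightarrow> chord_deviation F u s v \<le> e / 2 * (v - u)"
      using chord_deviation_small_if_differentiable[OF t, of "e / 2"] by auto
    \<comment> \<open>Once the mesh is below \<delta>, whichever interval contains \<open>t\<close>
      is short enough. Here \<open>N\<close> depends on \<open>t\<close>, so the convergence is only
      pointwise.\<close>
    obtain N where N: "\<And>n. n \<ge> N \<Longrightarrow> \<epsilon> n < \<delta>"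
      using order_tendstoD(2)[OF \<epsilon> \<delta>] unfolding eventually_sequentially by blast
    have "norm (E n t - 0) < e" if "n \<ge> N" for n
    proof (cases "\<exists>i\<in>{1..j n}. t \<in> {r n (i - 1)<..<r n i}")
      case True
      then obtain i where i: "i \<in> {1..j n}" "t \<in> {r n (i - 1)<..<r n i}" by blast
      have "r n i - r n (i - 1) < \<delta>" using mesh[of n] i(1) N[OF that] by fastforce
      then have "q n i \<le> e / 2"
        using small[of "r n (i - 1)" "r n i" "s n i"] i rs[of n] by (auto simp: q_def divide_le_eq)
      then show ?thesis using E_eq[OF i] q(1)[OF i(1)] \<open>e > 0\<close> by simp
    next
      case False
      then show ?thesis using E_0[of n t] \<open>e > 0\<close> by auto
    qed
    then show "\<exists>N. \<forall>n\<ge>N. norm (E n t - 0) < e" by blast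
  qed
  have "(\<lambda>n. integral\<^sup>L lebesgue (E n)) \<longlonglongrightarrow> integral\<^sup>L lebesgue (\<lambda>_::real. 0::real)"
  proof (rule integral_dominated_convergence[where w="\<lambda>t. 2 * L * indicator {a..b} t"])
    show "E n \<in> borel_measurable lebesgue" for n
      unfolding E_def
      by (intro borel_measurable_sum borel_measurable_times borel_measurable_indicator) auto
    show "AE t in lebesgue. (\<lambda>n. E n t) \<longlonglongrightarrow> 0"
      using diff by eventually_elim (rule lim)
    show "integrable lebesgue (\<lambda>t. 2 * L * indicator {a..b} t)"
      by (intro integrable_mult_right) (auto simp: emeasure_lborel_Icc_eq)
  qed (use bound in auto)
  moreover have
    "integral\<^sup>L lebesgue (E n) = (\<Sum>i=1..j n. chord_deviation F (r n (i - 1)) (s n i) (r n i))" for n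
  proof -
    have I: "integrable lebesgue (\<lambda>t::real. q n i * indicator {r n (i - 1)<..<r n i} t)" for i
      by (intro integrable_mult_right integrable_real_indicator)
        (auto intro!: emeasure_bounded_finite[unfolded infinity_ennreal_def])
    have "integral\<^sup>L lebesgue (E n) = (\<Sum>i=1..j n. q n i * measure lebesgue {r n (i - 1)<..<r n i})"
      unfolding E_def using I by (subst Bochner_Integration.integral_sum) auto
    also have "\<dots> = (\<Sum>i=1..j n. chord_deviation F (r n (i - 1)) (s n i) (r n i))"
    proof (rule sum.cong[OF refl])
      fix i assume "i \<in> {1..j n}"
      then have "r n (i - 1) < r n i" using r by blast
      then show "q n i * measure lebesgue {r n (i - 1)<..<r n i} =
          chord_deviation F (r n (i - 1)) (s n i) (r n i)"
        by (simp add: q_def)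
    qed
    finally show ?thesis .
  qed
  ultimately show ?thesis by simp
qed

section \<open>Finite point sets and nets in an interval\<close>

text \<open>Thickness speaks of increasing sequences, while the construction below collects points
  in sets. Sorting passes from one to the other; as \<open>P\<close> lies in \<open>[a, b]\<close>,
  the points \<open>a\<close> and \<open>b\<close> must come first and last.\<close>

lemma finite_set_subdivision:
  fixes P :: "real set"
  assumes "finite P" "P \<subseteq> {a..b}" "a \<in> P" "b \<in> P"
  obtains k and t :: "nat \<Rightarrow> real"
    where "t 0 = a" "t k = b" "\<forall>i<k. t i < t (Suc i)" "t ` {0..k} = P"
proof -
  define xs where "xs = sorted_list_of_set P"
  have xs: "set xs = P" "sorted_wrt (<) xs"
    using assms(1) by (auto simp: xs_def)
  then have ne: "xs \<noteq> []" using assms by auto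
  have less: "xs ! m < xs ! n" if "m < n" "n < length xs" for m n
    using xs(2) that by (simp add: sorted_wrt_iff_nth_less)
  have bounds: "a \<le> xs ! n" "xs ! n \<le> b" if "n < length xs" for n
    using that xs(1) assms(2) nth_mem by fastforce+
  define k where "k = length xs - 1"
  have k: "length xs = Suc k" using ne by (simp add: k_def)
  obtain m where m: "m \<le> k" "xs ! m = a"
    using assms(3) xs(1) k by (metis in_set_conv_nth less_Suc_eq_le)
  obtain n where n: "n \<le> k" "xs ! n = b"
    using assms(4) xs(1) k by (metis in_set_conv_nth less_Suc_eq_le)
  have "m = 0" using less[of 0 m] bounds(1)[of 0] m k by fastforce
  have "n = k" using less[of n k] bounds(2)[of k] n k by fastforce
  show thesis
  proof
    show "xs ! 0 = a" "xs ! k = b" using m n \<open>m = 0\<close> \<open>n = k\<close> by auto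
    show "\<forall>i<k. xs ! i < xs ! Suc i" using less k by simp
    have "(!) xs ` {0..k} = set xs" unfolding set_conv_nth k by (auto simp: less_Suc_eq_le)
    then show "(!) xs ` {0..k} = P" using xs(1) by simp
  qed
qed

lemma finite_net_Icc:
  assumes "e > 0"
  obtains G where "finite G" "G \<subseteq> {a..b::real}" "\<And>x. x \<in> {a..b} \<Longrightarrow> \<exists>g\<in>G. \<bar>x - g\<bar> < e"
proof -
  obtain G where G: "finite G" "G \<subseteq> {a..b}" "{a..b} \<subseteq> (\<Union>g\<in>G. ball g e)"
    using compactE_image[of "{a..b}" "{a..b}" "\<lambda>g. ball g e"] assms
    by (metis UN_I centre_in_ball compact_Icc open_ball subsetI)
  show thesis
  proof (rule that[OF G(1,2)])
    fix x assume "x \<in> {a..b}"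
    then obtain g where "g \<in> G" "x \<in> ball g e" using G(3) by blast
    then show "\<exists>g\<in>G. \<bar>x - g\<bar> < e" by (auto simp: dist_real_def abs_minus_commute)
  qed
qed

section \<open>One refinement step\<close>

context Metric_space
begin

text \<open>Thickness is applied to a subdivision containing \<open>P\<close> and a fine net. The
  curves \<gamma> and \<open>\<gamma>1\<close> agree at the points \<open>r i\<close>, so their
  images under \<open>f\<close> have common chords. The two total deviations therefore add up to at
  least \<open>c * \<alpha>\<close>, and the curve with the larger one serves as
  \<open>\<gamma>'\<close>. It agrees with \<gamma> on \<open>P\<close> in either case.\<close>

lemma thick_family_step:
  fixes f :: "'a \<Rightarrow> 'b::real_normed_vector"
  assumes f: "c > 0" "\<And>x y. x \<in> M \<Longrightarrow> y \<in> M \<Longrightarrow> c * d x y \<le> dist (f x) (f y)"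
    and \<Gamma>: "\<And>\<gamma>. \<gamma> \<in> \<Gamma> \<Longrightarrow> geodesic_between p q a b \<gamma>"
    and thick: "\<forall>\<gamma>\<in>\<Gamma>. \<forall>(k::nat) (t::nat \<Rightarrow> real).
      t 0 = a \<and> t k = b \<and> (\<forall>i<k. t i < t (Suc i)) \<longrightarrow>
      (\<exists>(j::nat) (r::nat \<Rightarrow> real) (s::nat \<Rightarrow> real). \<exists>\<gamma>'\<in>\<Gamma>.
        r 0 = a \<and> r j = b \<and> (\<forall>i\<in>{1..j}. r (i - 1) < s i \<and> s i < r i) \<and>
        t ` {0..k} \<subseteq> r ` {0..j} \<and> (\<forall>i\<in>{0..j}. \<gamma> (r i) = \<gamma>' (r i)) \<and>
        (\<Sum>i=1..j. d (\<gamma> (s i)) (\<gamma>' (s i))) \<ge> \<alpha>)"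
    and \<gamma>: "\<gamma> \<in> \<Gamma>" and P: "finite P" "P \<subseteq> {a..b}" and e: "e > 0"
  obtains \<gamma>' and j :: nat and r s :: "nat \<Rightarrow> real" and P' where
    "\<gamma>' \<in> \<Gamma>" "r 0 = a" "r j = b" "\<forall>i\<in>{1..j}. r (i - 1) < s i \<and> s i < r i"
    "\<forall>i\<in>{1..j}. r i - r (i - 1) < e"
    "(\<Sum>i=1..j. chord_deviation (f \<circ> \<gamma>') (r (i - 1)) (s i) (r i)) \<ge> c * \<alpha> / 2"
    "finite P'" "P \<subseteq> P'" "P' \<subseteq> {a..b}" "r ` {0..j} \<subseteq> P'" "s ` {1..j} \<subseteq> P'"
    "\<forall>x\<in>{a..b}. \<exists>y\<in>P'. \<bar>x - y\<bar> < e" "\<forall>x\<in>P. \<gamma>' x = \<gamma> x"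
proof -
  have "a \<le> b" using \<Gamma>[OF \<gamma>] by (simp add: geodesic_between_def)
  obtain G where G: "finite G" "G \<subseteq> {a..b}" "\<And>x. x \<in> {a..b} \<Longrightarrow> \<exists>g\<in>G. \<bar>x - g\<bar> < e / 2"
    using finite_net_Icc[of "e / 2"] e by (metis half_gt_zero)
  define T where "T = P \<union> G \<union> {a, b}"
  have T: "finite T" "T \<subseteq> {a..b}" "a \<in> T" "b \<in> T"
    using P G \<open>a \<le> b\<close> by (auto simp: T_def)
  obtain k and t :: "nat \<Rightarrow> real"
    where t: "t 0 = a" "t k = b" "\<forall>i<k. t i < t (Suc i)" "t ` {0..k} = T"
    by (rule finite_set_subdivision[OF T])
  obtain j :: nat and r s :: "nat \<Rightarrow> real" and \<gamma>1 where \<gamma>1: "\<gamma>1 \<in> \<Gamma>" and ends: "r 0 = a" "r j = b"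
    and rs: "\<forall>i\<in>{1..j}. r (i - 1) < s i \<and> s i < r i"
    and Tr: "T \<subseteq> r ` {0..j}" and agree: "\<forall>i\<in>{0..j}. \<gamma> (r i) = \<gamma>1 (r i)"
    and ge: "(\<Sum>i=1..j. d (\<gamma> (s i)) (\<gamma>1 (s i))) \<ge> \<alpha>"
    using thick[rule_format, OF \<gamma>, OF conjI[OF t(1) conjI[OF t(2,3)]]] unfolding t(4)
    by (elim exE bexE conjE) (rule that; assumption)
  have r: "\<forall>i\<in>{1..j}. r (i - 1) < r i" using rs by fastforce
  have r_in: "r i \<in> {a..b}" if "i \<le> j" for i
    using subdivision_le[OF r, of 0 i] subdivision_le[OF r, of i j] that ends by auto
  have r_in': "r (i - 1) \<in> {a..b}" "r i \<in> {a..b}" if "i \<in> {1..j}" for i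
    by (rule r_in, use that in force)+
  have s_in: "s i \<in> {a..b}" if "i \<in> {1..j}" for i
    using r_in'[OF that] bspec[OF rs that] by simp
  \<comment> \<open>An interval of length at least \<open>e\<close> would have a net point at
    distance less than \<open>e / 2\<close> from its midpoint, hence strictly inside. But all net
    points are among the \<open>r i\<close>.\<close>
  have mesh: "r i - r (i - 1) < e" if i: "i \<in> {1..j}" for i
  proof (rule ccontr)
    assume long: "\<not> r i - r (i - 1) < e"
    have "(r (i - 1) + r i) / 2 \<in> {a..b}" using r_in'[OF i] by simp
    then obtain g where g: "g \<in> G" "\<bar>(r (i - 1) + r i) / 2 - g\<bar> < e / 2" using G(3) by blast
    then have "g \<in> {r (i - 1)<..<r i}" using long by (auto simp: abs_if field_simps split: if_splits)
    moreover have "g \<in> r ` {0..j}" using g(1) Tr by (auto simp: T_def)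
    ultimately show False using subdivision_no_point_between[OF r i] by blast
  qed
  let ?S = "\<lambda>\<gamma>. \<Sum>i=1..j. chord_deviation (f \<circ> \<gamma>) (r (i - 1)) (s i) (r i)"
  have "c * \<alpha> \<le> c * (\<Sum>i=1..j. d (\<gamma> (s i)) (\<gamma>1 (s i)))"
    using f(1) ge by simp
  also have "\<dots> \<le> (\<Sum>i=1..j. chord_deviation (f \<circ> \<gamma>) (r (i - 1)) (s i) (r i) +
      chord_deviation (f \<circ> \<gamma>1) (r (i - 1)) (s i) (r i))"
    unfolding sum_distrib_left
  proof (rule sum_mono)
    fix i assume i: "i \<in> {1..j}"
    have "\<gamma> (s i) \<in> M" "\<gamma>1 (s i) \<in> M"
      using \<Gamma>[OF \<gamma>] \<Gamma>[OF \<gamma>1] s_in[OF i] by (auto simp: geodesic_between_def)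
    then have "c * d (\<gamma> (s i)) (\<gamma>1 (s i)) \<le> norm ((f \<circ> \<gamma>) (s i) - (f \<circ> \<gamma>1) (s i))"
      using f(2) by (simp add: dist_norm)
    also have "\<dots> \<le> chord_deviation (f \<circ> \<gamma>) (r (i - 1)) (s i) (r i) +
        chord_deviation (f \<circ> \<gamma>1) (r (i - 1)) (s i) (r i)"
      using agree i by (intro norm_diff_le_chord_deviation) auto
    finally show "c * d (\<gamma> (s i)) (\<gamma>1 (s i)) \<le> chord_deviation (f \<circ> \<gamma>) (r (i - 1)) (s i) (r i) +
        chord_deviation (f \<circ> \<gamma>1) (r (i - 1)) (s i) (r i)" .
  qed
  also have "\<dots> = ?S \<gamma> + ?S \<gamma>1" by (rule sum.distrib)
  finally have "?S \<gamma> \<ge> c * \<alpha> / 2 \<or> ?S \<gamma>1 \<ge> c * \<alpha> / 2" by linarith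
  then obtain \<gamma>' where \<gamma>': "\<gamma>' = \<gamma> \<or> \<gamma>' = \<gamma>1" "?S \<gamma>' \<ge> c * \<alpha> / 2" by blast
  show thesis
  \<comment> \<open>The points \<open>s i\<close> are put into \<open>P'\<close> along with the
    \<open>r i\<close>: later curves then keep the values on which the deviation just achieved
    depends.\<close>
  proof (rule that[of \<gamma>' r j s "r ` {0..j} \<union> s ` {1..j}"])
    show "\<gamma>' \<in> \<Gamma>" using \<gamma>'(1) \<gamma> \<gamma>1 by blast
    show "P \<subseteq> r ` {0..j} \<union> s ` {1..j}" using Tr by (auto simp: T_def)
    show "\<forall>x\<in>{a..b}. \<exists>y\<in>r ` {0..j} \<union> s ` {1..j}. \<bar>x - y\<bar> < e"
    proof
      fix x assume "x \<in> {a..b}"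
      then obtain g where "g \<in> G" "\<bar>x - g\<bar> < e / 2" using G(3) by blast
      moreover from this have "g \<in> r ` {0..j}" using Tr by (auto simp: T_def)
      ultimately show "\<exists>y\<in>r ` {0..j} \<union> s ` {1..j}. \<bar>x - y\<bar> < e" using e by force
    qed
    show "\<forall>x\<in>P. \<gamma>' x = \<gamma> x"
    proof
      fix x assume "x \<in> P"
      then have "x \<in> r ` {0..j}" using Tr by (auto simp: T_def)
      then show "\<gamma>' x = \<gamma> x" using agree \<gamma>'(1) by auto
    qed
    show "r ` {0..j} \<union> s ` {1..j} \<subseteq> {a..b}" using r_in s_in by auto
  qed (use ends rs mesh \<gamma>'(2) in auto)
qed

end

section \<open>The limit curve\<close>

text \<open>At each point of the union of the \<open>P n\<close> the values are eventually constant,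
  and this union is dense in \<open>[a, b]\<close>. The common Lipschitz constant carries the Cauchy
  property over to all other points, and completeness gives the limit.\<close>

lemma lipschitz_limit_of_refinements:
  fixes g :: "nat \<Rightarrow> real \<Rightarrow> 'b::banach"
  assumes lip: "\<And>n. C-lipschitz_on {a..b} (g n)"
    and P: "\<And>n. P n \<subseteq> {a..b}" "\<And>n. P n \<subseteq> P (Suc n)"
    and agree: "\<And>n x. x \<in> P n \<Longrightarrow> g (Suc n) x = g n x"
    and dense: "\<And>n x. x \<in> {a..b} \<Longrightarrow> \<exists>y\<in>P (Suc n). \<bar>x - y\<bar> < \<epsilon> n" and \<epsilon>: "\<epsilon> \<longlonglongrightarrow> 0"
  obtains h where "C-lipschitz_on {a..b} h" "\<And>n x. x \<in> P n \<Longrightarrow> h x = g n x"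
proof -
  have C: "0 \<le> C" using lip by (rule lipschitz_on_nonneg)
  have P_mono: "P n \<subseteq> P m" if "n \<le> m" for n m using P(2) that by (rule lift_Suc_mono_le)
  have agree': "g m x = g n x" if "n \<le> m" "x \<in> P n" for n m x
    using that(1)
  proof (induction m rule: dec_induct)
    case (step m)
    then show ?case using agree[of x m] P_mono[of n m] that(2) by auto
  qed simp
  have conv: "convergent (\<lambda>n. g n x)" if x: "x \<in> {a..b}" for x
  proof (rule Cauchy_convergent, rule metric_CauchyI)
    fix e :: real assume "e > 0"
    \<comment> \<open>\<open>C + 1\<close> keeps the divisor positive when \<open>C\<close> is
      zero.\<close>
    then have "e / (4 * (C + 1)) > 0" using C by simp
    then obtain N where "\<epsilon> N < e / (4 * (C + 1))"
      using order_tendstoD(2)[OF \<epsilon>] unfolding eventually_sequentially by blast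
    moreover obtain y where y: "y \<in> P (Suc N)" "\<bar>x - y\<bar> < \<epsilon> N" using dense[OF x] by blast
    ultimately have "\<bar>x - y\<bar> < e / (4 * (C + 1))" by linarith
    then have *: "\<bar>x - y\<bar> * (4 * (C + 1)) < e" using C by (simp add: pos_less_divide_eq)
    have "C * z < e / 2" if "z * (4 * (C + 1)) < e" "0 \<le> z" for z
    proof -
      have "z * (4 * (C + 1)) = 4 * (C * z) + 4 * z" by (simp add: algebra_simps)
      moreover have "0 \<le> C * z" using C that(2) by simp
      ultimately show ?thesis using that by linarith
    qed
    then have close: "C * \<bar>x - y\<bar> < e / 2" using * by simp
    \<comment> \<open>From index \<open>Suc N\<close> on the value at \<open>y\<close> no longer
      changes, so every later curve is compared with the same point
      \<open>g (Suc N) y\<close>.\<close>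
    have near: "dist (g m x) (g (Suc N) y) < e / 2" if "m \<ge> Suc N" for m
      using lipschitz_onD[OF lip[of m] x, of y] subsetD[OF P(1) y(1)] agree'[OF that y(1)] close
      by (auto simp: dist_real_def)
    have "dist (g m x) (g n x) < e" if "m \<ge> Suc N" "n \<ge> Suc N" for m n
      using near[OF that(1)] near[OF that(2)] by (rule dist_triangle_half_l)
    then show "\<exists>N. \<forall>m\<ge>N. \<forall>n\<ge>N. dist (g m x) (g n x) < e" by blast
  qed
  define h where "h x = lim (\<lambda>n. g n x)" for x
  have h: "(\<lambda>n. g n x) \<longlonglongrightarrow> h x" if "x \<in> {a..b}" for x
    using conv[OF that] by (simp add: h_def convergent_LIMSEQ_iff)
  show thesis
  proof
    show "C-lipschitz_on {a..b} h"
    proof (rule lipschitz_onI[OF _ C])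
      fix x y assume "x \<in> {a..b}" "y \<in> {a..b}"
      then show "dist (h x) (h y) \<le> C * dist x y"
        using lipschitz_onD[OF lip] by (intro LIMSEQ_le_const2[OF tendsto_dist[OF h h]]) auto
    qed
    show "h x = g n x" if "x \<in> P n" for n x
    proof (rule LIMSEQ_unique[OF h])
      show "x \<in> {a..b}" using that P(1) by blast
      have "eventually (\<lambda>m. g m x = g n x) sequentially"
        using eventually_ge_at_top[of n] by eventually_elim (rule agree'[OF _ that])
      then show "(\<lambda>m. g m x) \<longlonglongrightarrow> g n x" by (rule tendsto_eventually)
    qed
  qed
qed

text \<open>Clamping to \<open>[a, b]\<close> does not increase distances. The extension is needed
  because the Radon-Nikodym property concerns maps on the whole line.\<close>

lemma lipschitz_on_extend_Icc:
  fixes h :: "real \<Rightarrow> 'b::metric_space"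
  assumes "C-lipschitz_on {a..b} h" "a \<le> b"
  shows "C-lipschitz_on UNIV (\<lambda>t. h (max a (min b t)))"
proof (rule lipschitz_onI)
  show C: "0 \<le> C" using assms(1) by (rule lipschitz_on_nonneg)
  fix x y :: real
  have "dist (h (max a (min b x))) (h (max a (min b y))) \<le> C * dist (max a (min b x)) (max a (min b y))"
    using assms(2) by (intro lipschitz_onD[OF assms(1)]) auto
  also have "\<dots> \<le> C * dist x y"
    by (intro mult_left_mono C) (auto simp: dist_real_def)
  finally show "dist (h (max a (min b x))) (h (max a (min b y))) \<le> C * dist x y" .
qed

section \<open>Iteration and contradiction\<close>

theorem corollary1p4:
  fixes M :: "'a set" and d :: "'a \<Rightarrow> 'a \<Rightarrow> real"
  assumes "Metric_space M d"
    and "\<exists>p q a b \<Gamma>. Metric_space.thick_family M d p q a b \<Gamma>"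
    and "radon_nikodym_property TYPE('b::banach)"
  shows "\<nexists>f :: 'a \<Rightarrow> 'b. Metric_space.bilipschitz_embedding M d f"
proof
  interpret Metric_space M d by fact
  assume "\<exists>f :: 'a \<Rightarrow> 'b. bilipschitz_embedding f"
  then obtain f :: "'a \<Rightarrow> 'b" and c C where c: "c > 0" "C > 0"
    and f: "\<And>x y. x \<in> M \<Longrightarrow> y \<in> M \<Longrightarrow> c * d x y \<le> dist (f x) (f y)"
      "\<And>x y. x \<in> M \<Longrightarrow> y \<in> M \<Longrightarrow> dist (f x) (f y) \<le> C * d x y"
    unfolding bilipschitz_embedding_def by blast
  obtain p q a b \<Gamma> where thick: "thick_family p q a b \<Gamma>" using assms(2) by blast
  have \<Gamma>: "\<And>\<gamma>. \<gamma> \<in> \<Gamma> \<Longrightarrow> geodesic_between p q a b \<gamma>"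
    using thick by (auto simp: thick_family_def)
  obtain \<gamma>0 where \<gamma>0: "\<gamma>0 \<in> \<Gamma>" using thick by (auto simp: thick_family_def)
  have "a \<le> b" using \<Gamma>[OF \<gamma>0] by (simp add: geodesic_between_def)
  obtain \<alpha> where \<alpha>: "\<alpha> > 0" and step: "\<forall>\<gamma>\<in>\<Gamma>. \<forall>(k::nat) (t::nat \<Rightarrow> real).
      t 0 = a \<and> t k = b \<and> (\<forall>i<k. t i < t (Suc i)) \<longrightarrow>
      (\<exists>(j::nat) (r::nat \<Rightarrow> real) (s::nat \<Rightarrow> real). \<exists>\<gamma>'\<in>\<Gamma>.
        r 0 = a \<and> r j = b \<and> (\<forall>i\<in>{1..j}. r (i - 1) < s i \<and> s i < r i) \<and>
        t ` {0..k} \<subseteq> r ` {0..j} \<and> (\<forall>i\<in>{0..j}. \<gamma> (r i) = \<gamma>' (r i)) \<and>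
        (\<Sum>i=1..j. d (\<gamma> (s i)) (\<gamma>' (s i))) \<ge> \<alpha>)"
    using thick unfolding thick_family_def by (elim conjE exE) (rule that)
  define \<epsilon> where "\<epsilon> n = inverse (real (Suc n))" for n
  have \<epsilon>: "\<epsilon> \<longlonglongrightarrow> 0" "\<And>n. \<epsilon> n > 0"
    using LIMSEQ_inverse_real_of_nat by (simp_all add: \<epsilon>_def[abs_def] del: of_nat_Suc)
  \<comment> \<open>\<open>S\<close> relates a curve and its set of frozen points to their
    successors. Membership in \<Gamma> and finiteness are left out, since they form the invariant of
    the dependent choice.\<close>
  define S where "S e \<gamma> P \<gamma>' P' j r s \<longleftrightarrow>
      r 0 = a \<and> r j = b \<and> (\<forall>i\<in>{1..j}. r (i - 1) < s i \<and> s i < r i) \<and>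
      (\<forall>i\<in>{1..j}. r i - r (i - 1) < e) \<and>
      (\<Sum>i=1..j. chord_deviation (f \<circ> \<gamma>') (r (i - 1)) (s i) (r i)) \<ge> c * \<alpha> / 2 \<and>
      P \<subseteq> P' \<and> r ` {0..j} \<subseteq> P' \<and> s ` {1..j} \<subseteq> P' \<and>
      (\<forall>x\<in>{a..b}. \<exists>y\<in>P'. \<bar>x - y\<bar> < e) \<and> (\<forall>x\<in>P. \<gamma>' x = \<gamma> x)"
    for e :: real and \<gamma> P \<gamma>' P' and j :: nat and r s :: "nat \<Rightarrow> real"
  have "\<exists>X. \<forall>n. (fst (X n) \<in> \<Gamma> \<and> finite (snd (X n)) \<and> snd (X n) \<subseteq> {a..b}) \<and>
      (\<exists>j r s. S (\<epsilon> n) (fst (X n)) (snd (X n)) (fst (X (Suc n))) (snd (X (Suc n))) j r s)"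
  proof (rule dependent_nat_choice)
    \<comment> \<open>The iteration starts from any geodesic in \<Gamma> with no point
      frozen.\<close>
    show "\<exists>x. fst x \<in> \<Gamma> \<and> finite (snd x) \<and> snd x \<subseteq> {a..b}"
      using \<gamma>0 by (intro exI[of _ "(\<gamma>0, {})"]) auto
    fix x :: "(real \<Rightarrow> 'a) \<times> real set" and n :: nat
    assume x: "fst x \<in> \<Gamma> \<and> finite (snd x) \<and> snd x \<subseteq> {a..b}"
    show "\<exists>y. (fst y \<in> \<Gamma> \<and> finite (snd y) \<and> snd y \<subseteq> {a..b}) \<and>
        (\<exists>j r s. S (\<epsilon> n) (fst x) (snd x) (fst y) (snd y) j r s)"
    proof (rule thick_family_step[where f=f and \<gamma>="fst x" and P="snd x" and e="\<epsilon> n",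
          OF c(1) f(1) \<Gamma> step])
      fix \<gamma>' P' and j :: nat and r s :: "nat \<Rightarrow> real"
      assume \<gamma>': "\<gamma>' \<in> \<Gamma>" and "r 0 = a" "r j = b" "\<forall>i\<in>{1..j}. r (i - 1) < s i \<and> s i < r i"
        "\<forall>i\<in>{1..j}. r i - r (i - 1) < \<epsilon> n"
        "(\<Sum>i=1..j. chord_deviation (f \<circ> \<gamma>') (r (i - 1)) (s i) (r i)) \<ge> c * \<alpha> / 2"
        and P': "finite P'" "snd x \<subseteq> P'" "P' \<subseteq> {a..b}" "r ` {0..j} \<subseteq> P'" "s ` {1..j} \<subseteq> P'"
        "\<forall>x\<in>{a..b}. \<exists>y\<in>P'. \<bar>x - y\<bar> < \<epsilon> n" "\<forall>y\<in>snd x. \<gamma>' y = fst x y"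
      then have "S (\<epsilon> n) (fst x) (snd x) \<gamma>' P' j r s" unfolding S_def by blast
      then show ?thesis using \<gamma>' P' by (intro exI[of _ "(\<gamma>', P')"]) auto
    qed (use x \<epsilon> in auto)
  qed
  then obtain X where X: "\<And>n. fst (X n) \<in> \<Gamma>" "\<And>n. snd (X n) \<subseteq> {a..b}"
    and "\<forall>n. \<exists>j r s. S (\<epsilon> n) (fst (X n)) (snd (X n)) (fst (X (Suc n))) (snd (X (Suc n))) j r s"
    by blast
  then obtain j r s where
    S: "\<And>n. S (\<epsilon> n) (fst (X n)) (snd (X n)) (fst (X (Suc n))) (snd (X (Suc n))) (j n) (r n) (s n)"
    by metis
  \<comment> \<open>Geodesics are isometric, so the upper constant \<open>C\<close> of the embedding
    serves all the curves at once.\<close>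
  have lip: "C-lipschitz_on {a..b} (f \<circ> fst (X n))" for n
  proof (rule lipschitz_onI)
    fix x y assume xy: "x \<in> {a..b}" "y \<in> {a..b}"
    then have "fst (X n) x \<in> M" "fst (X n) y \<in> M" "d (fst (X n) x) (fst (X n) y) = dist x y"
      using \<Gamma>[OF X(1)[of n]] by (auto simp: geodesic_between_def)
    then show "dist ((f \<circ> fst (X n)) x) ((f \<circ> fst (X n)) y) \<le> C * dist x y"
      using f(2)[of "fst (X n) x" "fst (X n) y"] by simp
  qed (use c in simp)
  obtain h where h: "C-lipschitz_on {a..b} h"
    and h_eq: "\<And>n x. x \<in> snd (X n) \<Longrightarrow> h x = (f \<circ> fst (X n)) x"
  proof (rule lipschitz_limit_of_refinements[OF lip X(2) _ _ _ \<epsilon>(1)])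
    show "snd (X n) \<subseteq> snd (X (Suc n))" for n using S[of n] by (simp add: S_def)
    show "(f \<circ> fst (X (Suc n))) x = (f \<circ> fst (X n)) x" if "x \<in> snd (X n)" for n x
      using S[of n] that by (simp add: S_def)
    show "\<exists>y\<in>snd (X (Suc n)). \<bar>x - y\<bar> < \<epsilon> n" if "x \<in> {a..b}" for n x
      using S[of n] that unfolding S_def by blast
    fix h assume "C-lipschitz_on {a..b} h" "\<And>n x. x \<in> snd (X n) \<Longrightarrow> h x = (f \<circ> fst (X n)) x"
    then show ?thesis by (rule that)
  qed
  define F where "F t = h (max a (min b t))" for t
  have F: "C-lipschitz_on UNIV F"
    unfolding F_def by (rule lipschitz_on_extend_Icc[OF h \<open>a \<le> b\<close>])
  have F_eq: "F x = (f \<circ> fst (X n)) x" if "x \<in> snd (X n)" for n x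
  proof -
    have "x \<in> {a..b}" using that X(2) by blast
    then have "max a (min b x) = x" by auto
    then show ?thesis using h_eq[OF that] by (simp add: F_def)
  qed
  have "AE x in lebesgue. F differentiable (at x)"
    using assms(3) F unfolding radon_nikodym_property_def by blast
  then have "(\<lambda>n. \<Sum>i=1..j n. chord_deviation F (r n (i - 1)) (s n i) (r n i)) \<longlonglongrightarrow> 0"
    using S unfolding S_def
    by (intro total_chord_deviation_vanishes[OF F _ _ _ _ _ \<epsilon>(1), where a=a and b=b]) blast+
  \<comment> \<open>The step from \<open>n\<close> to \<open>Suc n\<close> bounds the deviation of
    the new curve, with index \<open>Suc n\<close>, and freezes the points \<open>r n i\<close> and
    \<open>s n i\<close>. There \<open>F\<close> has the values of that curve, so the bound passes
    to \<open>F\<close>.\<close>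
  moreover have "c * \<alpha> / 2 \<le> (\<Sum>i=1..j n. chord_deviation F (r n (i - 1)) (s n i) (r n i))" for n
  proof -
    have mem: "r n (i - 1) \<in> snd (X (Suc n))" "s n i \<in> snd (X (Suc n))" "r n i \<in> snd (X (Suc n))"
      if "i \<in> {1..j n}" for i
      using S[of n] that by (auto simp: S_def image_subset_iff)
    have "(\<Sum>i=1..j n. chord_deviation F (r n (i - 1)) (s n i) (r n i)) =
        (\<Sum>i=1..j n. chord_deviation (f \<circ> fst (X (Suc n))) (r n (i - 1)) (s n i) (r n i))"
      by (intro sum.cong refl chord_deviation_cong F_eq mem)
    then show ?thesis using S[of n] by (simp add: S_def)
  qed
  ultimately have "c * \<alpha> / 2 \<le> 0" by (intro LIMSEQ_le_const) auto
  then show False using c \<alpha> by (simp add: mult_le_0_iff)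
qed

end
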